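(* Let $B_0=\{x\in c_0:\|x\|_\infty\le 1\}$ be the closed unit ball of $c_0$, and let $F\colon B_0\to B_0$ be a non-expansive bijection. If $F^{-1}$ is continuous, then $F$ is an isometry, i.e. $\|F(x)-F(y)\|_\infty=\|x-y\|_\infty$ for all $x,y\in B_0$.
   Context: $c_0$ denotes the Banach space of real sequences indexed by $\mathbb{N}=\{1,2,\dots\}$ converging to $0$, with the supremum norm $\|\cdot\|_\infty$. A map $F$ between metric spaces is non-expansive if $d(F(a),F(b))\le d(a,b)$ for all $a,b$. *)

theory Defs
  imports "HOL-Analysis.Analysis"
begin

text \<open>
  As \<^typ>\<open>nat\<close> carries the discrete topology, \<^typ>\<open>nat \<Rightarrow>\<^sub>C real\<close> is the space of all bounded real
  sequences with the supremum norm, and \<open>c\<^sub>0\<close> is the subspace of null sequences in it. The sequences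
  are indexed from 0 rather than from 1.
\<close>

definition c0 :: "(nat \<Rightarrow>\<^sub>C real) set" where
  "c0 = {x. (\<lambda>n. apply_bcontfun x n) \<longlonglongrightarrow> 0}"

definition c0_unit_ball :: "(nat \<Rightarrow>\<^sub>C real) set" where
  "c0_unit_ball = {x \<in> c0. norm x \<le> 1}"

lemma norm_bounded_seq_eq_SUP:
  fixes x :: "nat \<Rightarrow>\<^sub>C real"
  shows "norm x = (SUP n. \<bar>apply_bcontfun x n\<bar>)"
  by (simp add: norm_bcontfun_def dist_bcontfun.rep_eq dist_real_def)

text \<open>Boundedness is no restriction: every real null sequence is represented in \<^const>\<open>c0\<close>.\<close>

lemma apply_bcontfun_image_c0:
  "apply_bcontfun ` c0 = {s :: nat \<Rightarrow> real. s \<longlonglongrightarrow> 0}"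
proof (intro set_eqI iffI)
  fix s :: "nat \<Rightarrow> real"
  assume "s \<in> {s. s \<longlonglongrightarrow> 0}"
  then have s: "s \<longlonglongrightarrow> 0" by simp
  then have "s \<in> bcontfun"
    by (auto simp: bcontfun_def intro: convergent_imp_bounded)
  then obtain x where "s = apply_bcontfun x" by (rule bcontfunE)
  with s show "s \<in> apply_bcontfun ` c0" by (auto simp: c0_def)
qed (auto simp: c0_def)

end

theory Submission
  imports Defs
begin

text \<open>
  If finitely many unit balls with centres in the unit ball \<open>B\<close> cover \<open>B\<close>, then so do the unit balls
  around the images of the centres, because \<open>F\<close> is a non-expansive surjection. In \<open>c\<^sub>0\<close> such a cover
  imposes a sign condition: whenever a nonzero coordinate is selected in each centre, two centres
  select the same coordinate and have opposite signs there. The cover by the balls around \<open>t e\<^sub>m\<close> and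
  \<open>- s e\<^sub>m\<close> shows that \<open>F\<close> maps the \<open>m\<close>-th axis into the \<open>\<psi> m\<close>-th axis, monotonically. The cover by
  the balls around a finitely supported \<open>x\<close> and the points \<open>- sgn x\<^sub>i e\<^sub>i\<close> shows that the coordinate
  \<open>\<psi> i\<close> of \<open>F x\<close> weakly has the sign prescribed by \<open>x\<^sub>i\<close>, and that \<open>F x\<close> vanishes elsewhere.
  Continuity of the inverse then gives that \<open>F\<close> maps each finite-dimensional coordinate cube onto
  such a cube. An expansive self-map of a compact space is an isometry, which applies to \<open>F\<^sup>-\<^sup>1\<close>
  followed by a permutation of the coordinates, and the finitely supported sequences are dense.
\<close>

section \<open>Expansive maps of compact spaces\<close>

lemma compact_recurrence:
  fixes u :: "nat \<Rightarrow> 'a::metric_space"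
  assumes "compact K" "\<And>n. u n \<in> K" "0 < \<epsilon>"
  obtains p q where "p < q" "dist (u p) (u q) < \<epsilon>"
proof -
  obtain l r where r: "strict_mono (r :: nat \<Rightarrow> nat)" and l: "(u \<circ> r) \<longlonglongrightarrow> l"
    using assms(1,2) unfolding compact_def by meson
  have "Cauchy (u \<circ> r)"
    using l by (rule LIMSEQ_imp_Cauchy)
  then obtain N where N: "\<And>m n. m \<ge> N \<Longrightarrow> n \<ge> N \<Longrightarrow> dist ((u \<circ> r) m) ((u \<circ> r) n) < \<epsilon>"
    using assms(3) unfolding Cauchy_def by meson
  show ?thesis
  proof
    show "r N < r (Suc N)" using r by (simp add: strict_mono_Suc_iff)
    show "dist (u (r N)) (u (r (Suc N))) < \<epsilon>" using N[of N "Suc N"] by simp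
  qed
qed

text \<open>Iterating \<open>g\<close> never decreases distances, so a recurrence of the pair
  \<open>(x, y)\<close> in \<open>K \<times> K\<close> yields some \<open>n > 0\<close> for which
  both points return near their start. The distance of \<open>g x\<close> and \<open>g y\<close> is
  at most that of the returned points.\<close>

lemma compact_expansive_isometry:
  fixes g :: "'a::metric_space \<Rightarrow> 'a"
  assumes K: "compact K" and gK: "g ` K \<subseteq> K"
    and expansive: "\<And>x y. x \<in> K \<Longrightarrow> y \<in> K \<Longrightarrow> dist x y \<le> dist (g x) (g y)"
    and x: "x \<in> K" and y: "y \<in> K"
  shows "dist (g x) (g y) = dist x y"
proof (rule antisym[OF _ expansive[OF x y]], rule field_le_epsilon)
  fix \<epsilon> :: real assume "0 < \<epsilon>"
  have in_K: "(g ^^ n) z \<in> K" if "z \<in> K" for n z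
    using that gK by (induction n) auto
  have expansive_pow: "dist z w \<le> dist ((g ^^ n) z) ((g ^^ n) w)" if "z \<in> K" "w \<in> K" for n z w
  proof (induction n)
    case (Suc n)
    also have "dist ((g ^^ n) z) ((g ^^ n) w) \<le> dist ((g ^^ Suc n) z) ((g ^^ Suc n) w)"
      using expansive[OF in_K[OF that(1)] in_K[OF that(2)]] by simp
    finally show ?case .
  qed simp
  \<comment> \<open>Recurrence in the product gives one pair of times that serves both
    points.\<close>
  obtain p q where pq: "p < q"
    and close: "dist ((g ^^ p) x, (g ^^ p) y) ((g ^^ q) x, (g ^^ q) y) < \<epsilon> / 2"
    using compact_recurrence[of "K \<times> K" "\<lambda>n. ((g ^^ n) x, (g ^^ n) y)" "\<epsilon> / 2"]
      in_K x y K \<open>0 < \<epsilon>\<close> by (auto intro: compact_Times)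
  define n where "n = q - p"
  have n: "n > 0" "(g ^^ q) z = (g ^^ p) ((g ^^ n) z)" for z
    using pq by (simp_all add: n_def flip: funpow_add[THEN fun_cong, unfolded o_apply])
  \<comment> \<open>As \<open>g ^^ p\<close> is expansive, closeness at times \<open>p\<close> and
    \<open>q\<close> pulls back to times 0 and \<open>n\<close>.\<close>
  have return: "dist z ((g ^^ n) z) < \<epsilon> / 2"
    if "z \<in> K" "dist ((g ^^ p) z) ((g ^^ q) z) < \<epsilon> / 2" for z
    using expansive_pow[OF that(1) in_K[OF that(1), of n], of p] that(2) n(2) by simp
  have "dist x ((g ^^ n) x) < \<epsilon> / 2"
    using return[OF x] close dist_fst_le[of "((g ^^ p) x, (g ^^ p) y)" "((g ^^ q) x, (g ^^ q) y)"]
    by simp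
  moreover have "dist y ((g ^^ n) y) < \<epsilon> / 2"
    using return[OF y] close dist_snd_le[of "((g ^^ p) x, (g ^^ p) y)" "((g ^^ q) x, (g ^^ q) y)"]
    by simp
  moreover have "dist ((g ^^ n) x) ((g ^^ n) y) \<le>
      dist x ((g ^^ n) x) + dist x y + dist y ((g ^^ n) y)"
    by metric
  moreover have "dist (g x) (g y) \<le> dist ((g ^^ n) x) ((g ^^ n) y)"
  proof -
    obtain k where "n = Suc k" using n(1) gr0_implies_Suc by blast
    then show ?thesis
      using expansive_pow[of "g x" "g y" k] gK x y
      by (auto simp: funpow_Suc_right simp del: funpow.simps)
  qed
  ultimately show "dist (g x) (g y) \<le> dist x y + \<epsilon>" by linarith
qed

section \<open>Finitely supported sequences\<close>

text \<open>\<open>Bcontfun\<close> returns the intended sequence only if that sequence is bounded,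
  which finiteness of \<open>S\<close> ensures.\<close>

definition restrict_seq :: "nat set \<Rightarrow> (nat \<Rightarrow> real) \<Rightarrow> (nat \<Rightarrow>\<^sub>C real)" where
  "restrict_seq S f = Bcontfun (\<lambda>n. if n \<in> S then f n else 0)"

abbreviation spike :: "nat \<Rightarrow> real \<Rightarrow> (nat \<Rightarrow>\<^sub>C real)" where
  "spike m t \<equiv> restrict_seq {m} (\<lambda>_. t)"

text \<open>For finite \<open>I\<close> this is the unit ball of the subspace spanned by the axes in
  \<open>I\<close>.\<close>

definition cube :: "nat set \<Rightarrow> (nat \<Rightarrow>\<^sub>C real) set" where
  "cube I = {x. (\<forall>n. \<bar>apply_bcontfun x n\<bar> \<le> 1) \<and> (\<forall>n. n \<notin> I \<longrightarrow> apply_bcontfun x n = 0)}"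

lemma bcontfun_eq_iff: "f = g \<longleftrightarrow> (\<forall>x. apply_bcontfun f x = apply_bcontfun g x)"
  by (auto intro: bcontfun_eqI)

lemma apply_Bcontfun_seq:
  fixes f :: "nat \<Rightarrow> real"
  assumes "bounded (range f)"
  shows "apply_bcontfun (Bcontfun f) = f"
  using assms by (intro Bcontfun_inverse) (simp add: bcontfun_def)

lemma apply_restrict_seq [simp]:
  assumes "finite S"
  shows "apply_bcontfun (restrict_seq S f) n = (if n \<in> S then f n else 0)"
proof -
  have "bounded (range (\<lambda>n. if n \<in> S then f n else 0))"
    by (rule finite_imp_bounded, rule finite_subset[of _ "insert 0 (f ` S)"]) (use assms in auto)
  then show ?thesis
    by (simp add: restrict_seq_def apply_Bcontfun_seq)
qed

lemma unit_ball_iff: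
  "x \<in> c0_unit_ball \<longleftrightarrow> apply_bcontfun x \<longlonglongrightarrow> 0 \<and> (\<forall>n. \<bar>apply_bcontfun x n\<bar> \<le> 1)"
  using norm_bounded[of x] norm_bound[of x 1]
  by (auto simp: c0_unit_ball_def c0_def intro: order_trans)

lemma abs_le_1_unit_ball: "x \<in> c0_unit_ball \<Longrightarrow> \<bar>apply_bcontfun x n\<bar> \<le> 1"
  by (simp add: unit_ball_iff)

lemma finite_support_in_unit_ball:
  assumes "finite {n. apply_bcontfun x n \<noteq> 0}" "\<And>n. \<bar>apply_bcontfun x n\<bar> \<le> 1"
  shows "x \<in> c0_unit_ball"
proof -
  have "eventually (\<lambda>n. apply_bcontfun x n = 0) sequentially"
    using assms(1) by (simp flip: cofinite_eq_sequentially add: eventually_cofinite)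
  then show ?thesis
    using assms(2) by (simp add: unit_ball_iff tendsto_eventually)
qed

lemma restrict_seq_in_unit_ball:
  assumes "finite S" "\<And>n. n \<in> S \<Longrightarrow> \<bar>f n\<bar> \<le> 1"
  shows "restrict_seq S f \<in> c0_unit_ball"
  using assms by (intro finite_support_in_unit_ball) auto

lemma spike_in_unit_ball: "\<bar>t\<bar> \<le> 1 \<Longrightarrow> spike m t \<in> c0_unit_ball"
  by (rule restrict_seq_in_unit_ball) auto

lemma spike_eq_0_iff [simp]: "spike m t = 0 \<longleftrightarrow> t = 0"
  by (auto simp: bcontfun_eq_iff)

lemma add_spike_in_unit_ball:
  assumes "x \<in> c0_unit_ball" "\<bar>apply_bcontfun x m + t\<bar> \<le> 1"
  shows "x + spike m t \<in> c0_unit_ball"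
proof -
  have "apply_bcontfun x \<longlonglongrightarrow> 0" "apply_bcontfun (spike m t) \<longlonglongrightarrow> 0" "\<forall>n. \<bar>apply_bcontfun x n\<bar> \<le> 1"
    using assms(1) spike_in_unit_ball[of t m]
    by (auto simp: unit_ball_iff intro!: tendsto_eventually eventually_sequentiallyI[of "Suc m"])
  then have "(\<lambda>n. apply_bcontfun x n + apply_bcontfun (spike m t) n) \<longlonglongrightarrow> 0 + 0"
    by (intro tendsto_add)
  then show ?thesis
    using assms(2) \<open>\<forall>n. \<bar>apply_bcontfun x n\<bar> \<le> 1\<close>
    by (auto simp: unit_ball_iff)
qed

lemma dist_coordinate_le: "\<bar>apply_bcontfun x n - apply_bcontfun y n\<bar> \<le> dist x (y :: nat \<Rightarrow>\<^sub>C real)"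
  using dist_bounded[of x n y] by (simp add: dist_real_def)

lemma dist_le_iff_coordinates:
  fixes x y :: "nat \<Rightarrow>\<^sub>C real"
  shows "dist x y \<le> r \<longleftrightarrow> (\<forall>n. \<bar>apply_bcontfun x n - apply_bcontfun y n\<bar> \<le> r)"
  using dist_coordinate_le[of x _ y] dist_bound[of x y r]
  by (auto simp: dist_real_def intro: order_trans)

lemma truncation_approximates:
  assumes x: "x \<in> c0_unit_ball" and "0 < \<epsilon>"
  obtains S where "finite S" "restrict_seq S (apply_bcontfun x) \<in> c0_unit_ball"
    "dist (restrict_seq S (apply_bcontfun x)) x < \<epsilon>"
proof -
  have "apply_bcontfun x \<longlonglongrightarrow> 0" using x by (simp add: unit_ball_iff)
  then obtain N where N: "\<And>n. n \<ge> N \<Longrightarrow> \<bar>apply_bcontfun x n\<bar> < \<epsilon> / 2"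
    using \<open>0 < \<epsilon>\<close> unfolding lim_sequentially by (metis diff_zero dist_real_def half_gt_zero)
  show ?thesis
  proof
    show "finite {..<N}" by simp
    show "restrict_seq {..<N} (apply_bcontfun x) \<in> c0_unit_ball"
      using x by (intro restrict_seq_in_unit_ball) (auto simp: unit_ball_iff)
    \<comment> \<open>Coordinatewise bounds control the supremum only weakly; the factor 1/2
      restores strictness.\<close>
    have "dist (restrict_seq {..<N} (apply_bcontfun x)) x \<le> \<epsilon> / 2"
      unfolding dist_le_iff_coordinates
    proof
      fix n
      show "\<bar>apply_bcontfun (restrict_seq {..<N} (apply_bcontfun x)) n - apply_bcontfun x n\<bar> \<le> \<epsilon> / 2"
        using N[of n] \<open>0 < \<epsilon>\<close> by (cases "n < N") auto
    qed
    then show "dist (restrict_seq {..<N} (apply_bcontfun x)) x < \<epsilon>"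
      using \<open>0 < \<epsilon>\<close> by simp
  qed
qed

lemma cube_subset_unit_ball: "finite I \<Longrightarrow> cube I \<subseteq> c0_unit_ball"
  by (auto simp: cube_def intro!: finite_support_in_unit_ball elim!: finite_subset[rotated])

text \<open>By induction, the cube over \<open>insert i I\<close> is the Minkowski sum of the cube
  over \<open>I\<close> and a segment of the \<open>i\<close>-th axis.\<close>

lemma compact_cube:
  assumes "finite I"
  shows "compact (cube I)"
  using assms
proof induction
  case empty
  have "cube {} = {0}" by (auto simp: cube_def bcontfun_eq_iff)
  then show ?case by simp
next
  case (insert i I)
  have "continuous_on {-1..1} (spike i)"
    unfolding continuous_on_iff
  proof (intro ballI allI impI)
    fix t \<epsilon> :: real assume "0 < \<epsilon>"
    have "dist (spike i s) (spike i t) \<le> dist s t" for s t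
      by (auto simp: dist_le_iff_coordinates dist_real_def)
    then show "\<exists>d>0. \<forall>s\<in>{-1..1}. dist s t < d \<longrightarrow> dist (spike i s) (spike i t) < \<epsilon>"
      using \<open>0 < \<epsilon>\<close> by (meson le_less_trans)
  qed
  then have "compact (spike i ` {-1..1})"
    by (rule compact_continuous_image) simp
  with insert.IH have "compact {x + y |x y. x \<in> cube I \<and> y \<in> spike i ` {-1..1}}"
    by (rule compact_sums)
  also have "{x + y |x y. x \<in> cube I \<and> y \<in> spike i ` {-1..1}} = cube (insert i I)"
  proof (intro set_eqI iffI)
    fix z assume z: "z \<in> cube (insert i I)"
    let ?x = "restrict_seq I (apply_bcontfun z)"
    have "z = ?x + spike i (apply_bcontfun z i)"
      using z insert.hyps by (auto simp: cube_def bcontfun_eq_iff)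
    moreover have "?x \<in> cube I" using z insert.hyps by (auto simp: cube_def)
    moreover have "apply_bcontfun z i \<in> {-1..1}" using z by (auto simp: cube_def abs_le_iff minus_le_iff)
    ultimately show "z \<in> {x + y |x y. x \<in> cube I \<and> y \<in> spike i ` {-1..1}}" by blast
  qed (use insert.hyps in \<open>auto simp: cube_def\<close>)
  finally show ?case .
qed

text \<open>For a permutation \<open>p\<close> this is an isometry; with \<open>\<psi>\<close> and
  its inverse it undoes the relabelling of axes by \<open>F\<close>.\<close>

definition reindex :: "(nat \<Rightarrow> nat) \<Rightarrow> (nat \<Rightarrow>\<^sub>C real) \<Rightarrow> (nat \<Rightarrow>\<^sub>C real)" where
  "reindex p x = Bcontfun (\<lambda>n. apply_bcontfun x (p n))"

lemma apply_reindex [simp]: "apply_bcontfun (reindex p x) n = apply_bcontfun x (p n)"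
proof -
  have "bounded (range (\<lambda>n. apply_bcontfun x (p n)))"
    using bounded_apply_bcontfun[of x] by (rule bounded_subset) auto
  then show ?thesis by (simp add: reindex_def apply_Bcontfun_seq)
qed

lemma dist_reindex_le: "dist (reindex p x) (reindex p y) \<le> dist x y"
  by (simp add: dist_le_iff_coordinates dist_coordinate_le)

section \<open>Covers by unit balls\<close>

text \<open>Without a conflict, each selected coordinate carries a single sign. The point with the
  opposite unit sign at every selected coordinate then lies outside all the balls.\<close>

lemma cover_sign_conflict:
  assumes V: "finite V" "\<And>y. y \<in> c0_unit_ball \<Longrightarrow> \<exists>v\<in>V. dist (h v) y \<le> 1"
    and \<kappa>: "\<And>v. v \<in> V \<Longrightarrow> apply_bcontfun (h v) (\<kappa> v) \<noteq> 0"
  shows "\<exists>v\<in>V. \<exists>w\<in>V. \<kappa> v = \<kappa> w \<and>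
    apply_bcontfun (h v) (\<kappa> v) * apply_bcontfun (h w) (\<kappa> w) < 0"
proof (rule ccontr)
  assume contra: "\<not> ?thesis"
  let ?c = "\<lambda>v. apply_bcontfun (h v) (\<kappa> v)"
  have same: "sgn (?c w) = sgn (?c v)" if "v \<in> V" "w \<in> V" "\<kappa> v = \<kappa> w" for v w
  proof -
    have "\<not> ?c v * ?c w < 0" using contra that by blast
    with \<kappa>[OF that(1)] \<kappa>[OF that(2)] show ?thesis
      by (simp add: sgn_if mult_less_0_iff) linarith
  qed
  \<comment> \<open>By \<open>same\<close>, the sign does not depend on which centre
    \<open>SOME\<close> picks.\<close>
  define y where "y = restrict_seq (\<kappa> ` V) (\<lambda>n. - sgn (?c (SOME v. v \<in> V \<and> \<kappa> v = n)))"
  have y: "apply_bcontfun y (\<kappa> v) = - sgn (?c v)" if "v \<in> V" for v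
  proof -
    define w where "w = (SOME w. w \<in> V \<and> \<kappa> w = \<kappa> v)"
    have "w \<in> V \<and> \<kappa> w = \<kappa> v"
      unfolding w_def by (rule someI[of _ v]) (use that in simp)
    then have "sgn (?c w) = sgn (?c v)" using that by (intro same) auto
    moreover have "apply_bcontfun y (\<kappa> v) = - sgn (?c w)"
      using that V(1) by (simp add: y_def w_def)
    ultimately show ?thesis by simp
  qed
  have "y \<in> c0_unit_ball"
    unfolding y_def using V(1) by (intro restrict_seq_in_unit_ball) (auto simp: sgn_if)
  then obtain v where v: "v \<in> V" "dist (h v) y \<le> 1" using V(2) by blast
  \<comment> \<open>The left side equals \<open>\<bar>?c v\<bar> + 1\<close>, since the coordinate
    is nonzero.\<close>
  have "\<bar>?c v + sgn (?c v)\<bar> \<le> 1"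
    using dist_coordinate_le[of "h v" "\<kappa> v" y] v(2) y[OF v(1)] by simp
  then show False using \<kappa>[OF v(1)] by (auto simp: sgn_if split: if_splits)
qed

text \<open>Two numbers in [-1, 1] more than 1 apart have strictly opposite signs. So
  \<open>y\<close> has the sign of the spike at such a coordinate \<open>i\<close>, and elsewhere
  the spike is 0, within 1 of \<open>y\<close>.\<close>

lemma unit_ball_cover_by_spikes:
  assumes x: "x \<in> c0_unit_ball" and y: "y \<in> c0_unit_ball" and far: "\<not> dist x y \<le> 1"
  obtains i where "apply_bcontfun x i \<noteq> 0" "dist (spike i (- sgn (apply_bcontfun x i))) y \<le> 1"
proof -
  obtain i where i: "\<bar>apply_bcontfun x i - apply_bcontfun y i\<bar> > 1"
    using far by (auto simp: dist_le_iff_coordinates not_le)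
  note bounds = abs_le_1_unit_ball[OF x, of i] abs_le_1_unit_ball[OF y]
  have xi: "apply_bcontfun x i \<noteq> 0" using i bounds(2)[of i] by auto
  have "\<bar>- sgn (apply_bcontfun x i) - apply_bcontfun y i\<bar> \<le> 1"
    using i xi bounds(1) bounds(2)[of i] by (auto simp: sgn_if abs_le_iff abs_if split: if_splits)
  then have "dist (spike i (- sgn (apply_bcontfun x i))) y \<le> 1"
    using bounds(2) by (auto simp: dist_le_iff_coordinates)
  with xi show ?thesis by (rule that)
qed

section \<open>Non-expansive bijections of the unit ball\<close>

locale nonexpansive_bijection =
  fixes F :: "(nat \<Rightarrow>\<^sub>C real) \<Rightarrow> (nat \<Rightarrow>\<^sub>C real)"
  assumes bij: "bij_betw F c0_unit_ball c0_unit_ball"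
    and nonexp: "\<And>x y. x \<in> c0_unit_ball \<Longrightarrow> y \<in> c0_unit_ball \<Longrightarrow> dist (F x) (F y) \<le> dist x y"
begin

lemma F_in: "x \<in> c0_unit_ball \<Longrightarrow> F x \<in> c0_unit_ball"
  using bij by (rule bij_betw_apply)

lemma F_inj: "F x = F y \<Longrightarrow> x \<in> c0_unit_ball \<Longrightarrow> y \<in> c0_unit_ball \<Longrightarrow> x = y"
  using bij by (auto simp: bij_betw_def inj_on_def)

lemma F_surj: "y \<in> c0_unit_ball \<Longrightarrow> \<exists>x\<in>c0_unit_ball. F x = y"
  using bij by (metis bij_betw_def imageE)

lemma image_cover:
  assumes "J \<subseteq> c0_unit_ball" "\<And>y. y \<in> c0_unit_ball \<Longrightarrow> \<exists>v\<in>J. dist v y \<le> 1"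
    and "y \<in> c0_unit_ball"
  shows "\<exists>v\<in>J. dist (F v) y \<le> 1"
  by (metis F_surj assms nonexp order_trans subsetD)

lemma cover_image_sign_conflict:
  assumes "finite J" "J \<subseteq> c0_unit_ball" "\<And>y. y \<in> c0_unit_ball \<Longrightarrow> \<exists>v\<in>J. dist v y \<le> 1"
    and "\<And>v. v \<in> J \<Longrightarrow> apply_bcontfun (F v) (\<kappa> v) \<noteq> 0"
  shows "\<exists>v\<in>J. \<exists>w\<in>J. \<kappa> v = \<kappa> w \<and>
    apply_bcontfun (F v) (\<kappa> v) * apply_bcontfun (F w) (\<kappa> w) < 0"
  using assms(1) image_cover[OF assms(2,3)] assms(4) by (rule cover_sign_conflict)

section \<open>Images of the coordinate axes\<close>

text \<open>The ball around 0 alone covers the unit ball, and a nonzero coordinate of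
  \<open>F 0\<close> cannot conflict in sign with itself.\<close>

lemma F_0: "F 0 = 0"
proof (rule ccontr)
  assume "F 0 \<noteq> 0"
  then obtain k where k: "apply_bcontfun (F 0) k \<noteq> 0" by (auto simp: bcontfun_eq_iff)
  have "\<exists>v\<in>{0}. \<exists>w\<in>{0}. k = k \<and> apply_bcontfun (F v) k * apply_bcontfun (F w) k < 0"
    by (rule cover_image_sign_conflict)
      (use k in \<open>auto simp: c0_unit_ball_def c0_def dist_norm\<close>)
  then show False by (simp add: mult_less_0_iff)
qed

lemma F_spike_nonzero:
  assumes "t \<noteq> 0" "\<bar>t\<bar> \<le> 1"
  obtains k where "apply_bcontfun (F (spike m t)) k \<noteq> 0"
proof -
  have "0 \<in> c0_unit_ball" by (simp add: c0_unit_ball_def c0_def)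
  then have "F (spike m t) \<noteq> 0"
    using F_inj[of "spike m t" 0] F_0 assms spike_in_unit_ball[of t m] by auto
  then show ?thesis using that by (auto simp: bcontfun_eq_iff)
qed

text \<open>The two balls cover the unit ball: a number in [-1, 1] is within 1 of whichever of
  \<open>s\<close>, \<open>t\<close> lies on its side of 0. The forced conflict must be between the
  two different centres.\<close>

lemma opposite_spikes:
  assumes st: "s * t < 0" "\<bar>s\<bar> \<le> 1" "\<bar>t\<bar> \<le> 1"
    and k: "apply_bcontfun (F (spike m s)) k \<noteq> 0" and j: "apply_bcontfun (F (spike m t)) j \<noteq> 0"
  shows "j = k" "apply_bcontfun (F (spike m s)) k * apply_bcontfun (F (spike m t)) k < 0"
proof -
  let ?J = "{spike m s, spike m t}" and ?\<kappa> = "\<lambda>v. if v = spike m s then k else j"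
  have ne: "spike m t \<noteq> spike m s"
    using st(1) by (auto simp: bcontfun_eq_iff mult_less_0_iff split: if_splits)
  have cover: "\<exists>v\<in>?J. dist v y \<le> 1" if y: "y \<in> c0_unit_ball" for y
  proof -
    have "\<bar>s - apply_bcontfun y m\<bar> \<le> 1 \<or> \<bar>t - apply_bcontfun y m\<bar> \<le> 1"
      using st abs_le_1_unit_ball[OF y, of m] by (auto simp: mult_less_0_iff abs_le_iff)
    then show ?thesis
      using abs_le_1_unit_ball[OF y] by (auto simp: dist_le_iff_coordinates)
  qed
  have "\<exists>v\<in>?J. \<exists>w\<in>?J. ?\<kappa> v = ?\<kappa> w \<and>
      apply_bcontfun (F v) (?\<kappa> v) * apply_bcontfun (F w) (?\<kappa> w) < 0"
    by (rule cover_image_sign_conflict)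
      (use st k j cover in \<open>auto simp: spike_in_unit_ball\<close>)
  then show "j = k" "apply_bcontfun (F (spike m s)) k * apply_bcontfun (F (spike m t)) k < 0"
    using ne by (auto simp: mult.commute mult_less_0_iff)
qed

text \<open>The choice turns out to be unique: \<open>F\<close> maps the whole \<open>m\<close>-th
  axis segment into the axis with index \<open>\<psi> m\<close>.\<close>

definition \<psi> :: "nat \<Rightarrow> nat" where
  "\<psi> m = (SOME k. apply_bcontfun (F (spike m 1)) k \<noteq> 0)"

text \<open>Its sign records whether \<open>F\<close> keeps or reverses the direction of the
  axis.\<close>

definition weight :: "nat \<Rightarrow> real" where
  "weight m = apply_bcontfun (F (spike m 1)) (\<psi> m)"

lemma weight_nonzero: "weight m \<noteq> 0"
  unfolding weight_def \<psi>_def by (rule someI_ex) (rule F_spike_nonzero[of 1 m], auto)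

text \<open>A negative \<open>t\<close> is opposite to 1 and is compared with
  \<open>spike m 1\<close> directly. A positive \<open>t\<close> is compared with
  \<open>spike m (-1)\<close>, which was itself compared with \<open>spike m 1\<close>.\<close>

lemma F_spike_support_sign:
  assumes t: "\<bar>t\<bar> \<le> 1" "t \<noteq> 0" and k: "apply_bcontfun (F (spike m t)) k \<noteq> 0"
  shows "k = \<psi> m" "0 < t * weight m * apply_bcontfun (F (spike m t)) (\<psi> m)"
proof -
  have neg: "k = \<psi> m \<and> weight m * apply_bcontfun (F (spike m t)) (\<psi> m) < 0"
    if "\<bar>t\<bar> \<le> 1" "t < 0" "apply_bcontfun (F (spike m t)) k \<noteq> 0" for t k
    using opposite_spikes[of 1 t m "\<psi> m" k] that weight_nonzero[of m] by (auto simp: weight_def)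
  have "k = \<psi> m \<and> 0 < t * weight m * apply_bcontfun (F (spike m t)) (\<psi> m)"
  proof (cases "t < 0")
    case True
    then show ?thesis using neg[OF t(1) _ k]
      by (simp add: mult.assoc mult_neg_neg)
  next
    case False
    obtain j where "apply_bcontfun (F (spike m (-1))) j \<noteq> 0"
      by (rule F_spike_nonzero[of "-1" m]) auto
    with neg[of "-1" j] have j: "apply_bcontfun (F (spike m (-1))) (\<psi> m) \<noteq> 0"
      "weight m * apply_bcontfun (F (spike m (-1))) (\<psi> m) < 0" by auto
    have "k = \<psi> m" "apply_bcontfun (F (spike m (-1))) (\<psi> m) * apply_bcontfun (F (spike m t)) (\<psi> m) < 0"
      using opposite_spikes[of "-1" t m "\<psi> m" k] False t j(1) k by auto
    then show ?thesis using j(2) False t(2)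
      by (auto simp: mult_less_0_iff zero_less_mult_iff)
  qed
  then show "k = \<psi> m" "0 < t * weight m * apply_bcontfun (F (spike m t)) (\<psi> m)" by auto
qed

lemma F_spike_sign:
  assumes "\<bar>t\<bar> \<le> 1" "t \<noteq> 0"
  shows "0 < t * weight m * apply_bcontfun (F (spike m t)) (\<psi> m)"
  using F_spike_nonzero[OF assms(2,1), of m] F_spike_support_sign(2)[OF assms] by blast

lemma F_spike_off_axis: "\<bar>t\<bar> \<le> 1 \<Longrightarrow> k \<noteq> \<psi> m \<Longrightarrow> apply_bcontfun (F (spike m t)) k = 0"
  by (metis F_0 F_spike_support_sign(1) spike_eq_0_iff zero_bcontfun.rep_eq)

lemma continuous_on_F_spike:
  "continuous_on {-1..1} (\<lambda>t. apply_bcontfun (F (spike m t)) k)"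
  unfolding continuous_on_iff
proof (intro ballI allI impI)
  fix t \<epsilon> :: real assume t: "t \<in> {-1..1}" and "0 < \<epsilon>"
  have "dist (apply_bcontfun (F (spike m s)) k) (apply_bcontfun (F (spike m t)) k) \<le> dist s t"
    if s: "s \<in> {-1..1}" for s
  proof -
    have "dist (F (spike m s)) (F (spike m t)) \<le> dist (spike m s) (spike m t)"
      using s t by (intro nonexp spike_in_unit_ball) auto
    also have "\<dots> \<le> dist s t"
      by (auto simp: dist_le_iff_coordinates dist_real_def)
    finally show ?thesis
      using dist_bounded order_trans by blast
  qed
  then show "\<exists>d>0. \<forall>s\<in>{-1..1}. dist s t < d \<longrightarrow>
      dist (apply_bcontfun (F (spike m s)) k) (apply_bcontfun (F (spike m t)) k) < \<epsilon>"
    using \<open>0 < \<epsilon>\<close> by (meson le_less_trans)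
qed

lemma inj_\<psi>: "inj \<psi>"
proof (rule injI, rule ccontr)
  fix a b assume ab: "\<psi> a = \<psi> b" "a \<noteq> b"
  let ?f = "\<lambda>m t. apply_bcontfun (F (spike m t)) (\<psi> a)"
  \<comment> \<open>The images of both axes would be intervals around 0 in the same axis, so they would share a nonzero point.\<close>
  have no_hit: False
    if mn: "m \<noteq> n" "\<psi> m = \<psi> a" "\<psi> n = \<psi> a" and s: "s \<in> {-1..1}" "s \<noteq> 0" and \<sigma>: "\<sigma> \<in> {-1..1}"
      and between: "0 \<le> ?f m s \<and> ?f m s \<le> ?f n \<sigma> \<or> ?f n \<sigma> \<le> ?f m s \<and> ?f m s \<le> 0" for m n s \<sigma>
  proof -
    have conn: "connected ((?f n) ` {-1..1})"
      by (intro connected_continuous_image continuous_on_F_spike) simp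
    have f0: "?f n 0 = 0" by (metis F_0 spike_eq_0_iff zero_bcontfun.rep_eq)
    have "?f m s \<in> ?f n ` {-1..1}"
    proof -
      have "?f n 0 \<in> ?f n ` {-1..1}" "?f n \<sigma> \<in> ?f n ` {-1..1}" using \<sigma> by auto
      then show ?thesis using connectedD_interval[OF conn] between f0 by metis
    qed
    then obtain \<tau> where \<tau>: "\<tau> \<in> {-1..1}" "?f m s = ?f n \<tau>" by auto
    have "F (spike m s) = F (spike n \<tau>)"
    proof (rule bcontfun_eqI)
      fix k show "apply_bcontfun (F (spike m s)) k = apply_bcontfun (F (spike n \<tau>)) k"
        using F_spike_off_axis[of s k m] F_spike_off_axis[of \<tau> k n] \<tau> s mn
        by (cases "k = \<psi> a") auto
    qed
    then have "spike m s = spike n \<tau>"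
      by (rule F_inj) (use s \<tau> in \<open>auto intro!: spike_in_unit_ball\<close>)
    then have "apply_bcontfun (spike m s) m = apply_bcontfun (spike n \<tau>) m" by simp
    then show False using mn(1) s(2) by simp
  qed
  have signs: "?f a 1 * weight a > 0" "?f b 1 * weight b > 0" "?f b (-1) * weight b < 0"
    using F_spike_sign[of 1 a] F_spike_sign[of 1 b] F_spike_sign[of "-1" b] ab
    by (simp_all add: mult.commute)
  \<comment> \<open>\<open>F\<close> sends the spikes 1 and -1 of the axis \<open>b\<close> to
    opposite sides of 0, so one of them lands on the side of \<open>F (spike a 1)\<close>.\<close>
  obtain \<sigma> :: real where \<sigma>: "\<sigma> \<in> {-1..1}" "\<sigma> \<noteq> 0" "?f a 1 * ?f b \<sigma> > 0"
  proof (cases "?f a 1 * ?f b 1 > 0")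
    case True
    then show ?thesis using that[of 1] by simp
  next
    case False
    then have "?f a 1 * ?f b (-1) > 0"
      using signs by (auto simp: zero_less_mult_iff mult_less_0_iff)
    then show ?thesis using that[of "-1"] by simp
  qed
  \<comment> \<open>The value nearer to 0 lies between 0 and the other, so the other axis attains
    it.\<close>
  from \<sigma>(3) consider
    "0 \<le> ?f a 1 \<and> ?f a 1 \<le> ?f b \<sigma> \<or> ?f b \<sigma> \<le> ?f a 1 \<and> ?f a 1 \<le> 0" |
    "0 \<le> ?f b \<sigma> \<and> ?f b \<sigma> \<le> ?f a 1 \<or> ?f a 1 \<le> ?f b \<sigma> \<and> ?f b \<sigma> \<le> 0"
    unfolding zero_less_mult_iff by linarith
  then show False
  proof cases
    case 1
    show False by (rule no_hit[OF _ _ _ _ _ _ 1]) (use ab \<sigma> in auto)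
  next
    case 2
    show False by (rule no_hit[OF _ _ _ _ _ _ 2]) (use ab \<sigma> in auto)
  qed
qed

section \<open>Signs and supports of images\<close>

lemma F_finite_support:
  assumes x: "x \<in> c0_unit_ball" and fin: "finite {n. apply_bcontfun x n \<noteq> 0}"
    and k: "apply_bcontfun (F x) k \<noteq> 0"
  shows "\<exists>i. k = \<psi> i \<and> 0 < weight i * apply_bcontfun x i * apply_bcontfun (F x) k"
proof -
  define e where "e i = spike i (- sgn (apply_bcontfun x i))" for i
  define S where "S = {n. apply_bcontfun x n \<noteq> 0}"
  define \<kappa> where "\<kappa> v = (if v = x then k else SOME j. apply_bcontfun (F v) j \<noteq> 0)" for v
  have ex: "e i \<noteq> x" if "i \<in> S" for i
  proof
    assume "e i = x"
    then have "apply_bcontfun (e i) i = apply_bcontfun x i" by simp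
    then show False using that by (simp add: e_def S_def sgn_if split: if_splits)
  qed
  have e_in: "e i \<in> c0_unit_ball" for i
    unfolding e_def by (rule spike_in_unit_ball) (simp add: sgn_if)
  have e_sign: "apply_bcontfun x i * weight i * apply_bcontfun (F (e i)) (\<psi> i) < 0" if "i \<in> S" for i
    using F_spike_sign[of "- sgn (apply_bcontfun x i)" i] that
    by (auto simp: e_def S_def sgn_if mult_less_0_iff zero_less_mult_iff split: if_splits)
  \<comment> \<open>The image of a spike vanishes off \<open>\<psi> i\<close>, so
    \<open>SOME\<close> can only pick that coordinate.\<close>
  have \<kappa>_e: "\<kappa> (e i) = \<psi> i" if "i \<in> S" for i
  proof -
    have "apply_bcontfun (F (e i)) (\<kappa> (e i)) \<noteq> 0"
      using ex[OF that] e_sign[OF that] unfolding \<kappa>_def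
      by simp (metis (mono_tags, lifting) mult_zero_right less_irrefl someI)
    then show ?thesis
      using F_spike_off_axis[of "- sgn (apply_bcontfun x i)"] by (auto simp: e_def sgn_if split: if_splits)
  qed
  have \<kappa>_x: "\<kappa> x = k" by (simp add: \<kappa>_def)
  have "\<exists>v\<in>insert x (e ` S). \<exists>w\<in>insert x (e ` S). \<kappa> v = \<kappa> w \<and>
      apply_bcontfun (F v) (\<kappa> v) * apply_bcontfun (F w) (\<kappa> w) < 0"
  proof (rule cover_image_sign_conflict)
    show "finite (insert x (e ` S))" using fin by (simp add: S_def)
    show "insert x (e ` S) \<subseteq> c0_unit_ball" using x e_in by auto
    show "\<exists>v\<in>insert x (e ` S). dist v y \<le> 1" if "y \<in> c0_unit_ball" for y
      using unit_ball_cover_by_spikes[OF x that] by (auto simp: e_def S_def)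
    show "apply_bcontfun (F v) (\<kappa> v) \<noteq> 0" if "v \<in> insert x (e ` S)" for v
      using that k \<kappa>_x \<kappa>_e e_sign by fastforce
  qed
  then obtain v w where vw: "v \<in> insert x (e ` S)" "w \<in> insert x (e ` S)" "\<kappa> v = \<kappa> w"
    "apply_bcontfun (F v) (\<kappa> v) * apply_bcontfun (F w) (\<kappa> w) < 0" by blast
  have "v \<noteq> w" using vw(4) by (auto simp: mult_less_0_iff)
  \<comment> \<open>Different spikes select different coordinates, so the conflict involves
    \<open>x\<close> and one spike.\<close>
  moreover have "\<not> (v \<in> e ` S \<and> w \<in> e ` S)"
    using vw(3) \<kappa>_e inj_\<psi> \<open>v \<noteq> w\<close> by (metis imageE injD)
  ultimately obtain i where i: "i \<in> S" "k = \<psi> i"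
    "apply_bcontfun (F x) k * apply_bcontfun (F (e i)) (\<psi> i) < 0"
    using vw \<kappa>_x \<kappa>_e by (auto simp: mult.commute)
  show ?thesis
    using i e_sign[OF i(1)] by (intro exI[of _ i]) (auto simp: mult_less_0_iff zero_less_mult_iff)
qed

text \<open>Weak inequalities survive limits: a truncation nearer to \<open>x\<close> than the size
  of \<open>F x\<close> at \<open>k\<close> has an image with the same strict sign there.\<close>

lemma F_truncation_limit:
  assumes x: "x \<in> c0_unit_ball"
    and finite_case: "\<And>S. finite S \<Longrightarrow> restrict_seq S (apply_bcontfun x) \<in> c0_unit_ball \<Longrightarrow>
      0 \<le> c * apply_bcontfun (F (restrict_seq S (apply_bcontfun x))) k"
  shows "0 \<le> c * apply_bcontfun (F x) k"
proof (rule ccontr)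
  assume neg: "\<not> 0 \<le> c * apply_bcontfun (F x) k"
  then have "0 < \<bar>apply_bcontfun (F x) k\<bar>" by auto
  then obtain S where S: "finite S" "restrict_seq S (apply_bcontfun x) \<in> c0_unit_ball"
    "dist (restrict_seq S (apply_bcontfun x)) x < \<bar>apply_bcontfun (F x) k\<bar>"
    using truncation_approximates[OF x] by metis
  let ?x' = "restrict_seq S (apply_bcontfun x)"
  have "\<bar>apply_bcontfun (F ?x') k - apply_bcontfun (F x) k\<bar> < \<bar>apply_bcontfun (F x) k\<bar>"
    using dist_coordinate_le[of "F ?x'" k "F x"] nonexp[OF S(2) x] S(3) by linarith
  moreover have "0 \<le> c * apply_bcontfun (F ?x') k" using finite_case S(1,2) by blast
  ultimately show False
    using neg by (auto simp: zero_le_mult_iff not_le mult_less_0_iff abs_if split: if_splits)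
qed

text \<open>The factor \<open>c\<close> treats both signs at once. If \<open>x\<close> vanishes at
  \<open>i\<close>, both 1 and -1 are admissible, which forces \<open>F x\<close> to vanish at
  \<open>\<psi> i\<close>.\<close>

lemma F_sign:
  assumes x: "x \<in> c0_unit_ball" and c: "0 \<le> c * apply_bcontfun x i"
  shows "0 \<le> c * weight i * apply_bcontfun (F x) (\<psi> i)"
proof (rule F_truncation_limit[OF x])
  fix S assume S: "finite S" "restrict_seq S (apply_bcontfun x) \<in> c0_unit_ball"
  let ?x' = "restrict_seq S (apply_bcontfun x)"
  have fin: "finite {n. apply_bcontfun ?x' n \<noteq> 0}" using S(1) by simp
  show "0 \<le> c * weight i * apply_bcontfun (F ?x') (\<psi> i)"
  proof (cases "apply_bcontfun (F ?x') (\<psi> i) = 0")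
    case False
    then have "0 < weight i * apply_bcontfun ?x' i * apply_bcontfun (F ?x') (\<psi> i)"
      using F_finite_support[OF S(2) fin] inj_\<psi> by (metis injD)
    then have i: "0 < weight i * apply_bcontfun x i * apply_bcontfun (F ?x') (\<psi> i)"
      using S(1) by (auto split: if_splits)
    \<comment> \<open>Both factors contain the coordinate of \<open>x\<close> at \<open>i\<close>;
      its square is positive and cancels.\<close>
    then have "0 \<le> (c * apply_bcontfun x i) *
        (weight i * apply_bcontfun x i * apply_bcontfun (F ?x') (\<psi> i))"
      using c by simp
    also have "\<dots> = (c * weight i * apply_bcontfun (F ?x') (\<psi> i)) * (apply_bcontfun x i)\<^sup>2"
      by (simp add: power2_eq_square)
    finally show ?thesis
      using i by (auto simp: zero_le_mult_iff)
  qed simp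
qed

lemma F_outside_range:
  assumes x: "x \<in> c0_unit_ball" and k: "k \<notin> range \<psi>"
  shows "apply_bcontfun (F x) k = 0"
proof -
  have "0 \<le> c * apply_bcontfun (F x) k" for c
  proof (rule F_truncation_limit[OF x])
    fix S assume S: "finite S" "restrict_seq S (apply_bcontfun x) \<in> c0_unit_ball"
    then have "apply_bcontfun (F (restrict_seq S (apply_bcontfun x))) k = 0"
      using F_finite_support[OF S(2) _, of k] k
      by (metis (mono_tags, lifting) S(1) apply_restrict_seq finite_subset mem_Collect_eq rangeI subsetI)
    then show "0 \<le> c * apply_bcontfun (F (restrict_seq S (apply_bcontfun x))) k" by simp
  qed
  from this[of 1] this[of "-1"] show ?thesis by simp
qed

text \<open>A unit vector on a missed axis would have no preimage.\<close>

lemma surj_\<psi>: "surj \<psi>"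
proof (rule ccontr)
  assume "\<not> surj \<psi>"
  then obtain k where k: "k \<notin> range \<psi>" by auto
  obtain x where "x \<in> c0_unit_ball" "F x = spike k 1"
    using F_surj[OF spike_in_unit_ball[of 1 k]] by auto
  with F_outside_range[OF _ k, of x] show False by simp
qed

lemma F_support:
  assumes "x \<in> c0_unit_ball" "apply_bcontfun x i = 0"
  shows "apply_bcontfun (F x) (\<psi> i) = 0"
  using F_sign[OF assms(1), of 1 i] F_sign[OF assms(1), of "-1" i] assms(2) weight_nonzero[of i]
  by (auto simp: zero_le_mult_iff mult_le_0_iff)

end

section \<open>Continuous inverse and isometry\<close>

locale nonexpansive_homeomorphism = nonexpansive_bijection +
  assumes continuous_inverse: "continuous_on c0_unit_ball (inv_into c0_unit_ball F)"
begin

abbreviation G where "G \<equiv> inv_into c0_unit_ball F"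

lemma G_in: "y \<in> c0_unit_ball \<Longrightarrow> G y \<in> c0_unit_ball"
  using bij by (metis bij_betw_def inv_into_into)

lemma F_G: "y \<in> c0_unit_ball \<Longrightarrow> F (G y) = y"
  using bij by (rule bij_betw_inv_into_right)

text \<open>If \<open>G y\<close> were nonzero at \<open>i\<close>, a small change of
  \<open>y\<close> at \<open>\<psi> i\<close> would keep that sign by continuity, yet can be given
  the sign that \<open>F_sign\<close> forbids.\<close>

lemma G_support:
  assumes y: "y \<in> c0_unit_ball" and 0: "apply_bcontfun y (\<psi> i) = 0"
  shows "apply_bcontfun (G y) i = 0"
proof (rule ccontr)
  define z where "z = apply_bcontfun (G y) i"
  assume "apply_bcontfun (G y) i \<noteq> 0"
  then have z: "z \<noteq> 0" by (simp add: z_def)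
  then obtain d where d: "d > 0" "\<And>y'. y' \<in> c0_unit_ball \<Longrightarrow> dist y' y < d \<Longrightarrow> dist (G y') (G y) < \<bar>z\<bar>"
    using continuous_inverse y unfolding continuous_on_iff by (metis zero_less_abs_iff)
  \<comment> \<open>The bound 1 keeps \<open>y'\<close> in the unit ball, and \<open>d / 2\<close>
    keeps it within the continuity radius.\<close>
  define \<delta> where "\<delta> = min 1 (d / 2)"
  have \<delta>: "0 < \<delta>" "\<delta> \<le> 1" "\<delta> < d" using d(1) by (auto simp: \<delta>_def)
  define t where "t = - sgn (z * weight i) * \<delta>"
  have t: "\<bar>t\<bar> = \<delta>" "z * weight i * t < 0"
    using \<delta> z weight_nonzero[of i] by (auto simp: t_def abs_mult sgn_if mult_less_0_iff zero_less_mult_iff)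
  define y' where "y' = y + spike (\<psi> i) t"
  have y': "y' \<in> c0_unit_ball"
    unfolding y'_def using y 0 t(1) \<delta> by (intro add_spike_in_unit_ball) auto
  have "dist y' y \<le> \<delta>"
    using t(1) \<delta>(1) by (auto simp: dist_le_iff_coordinates y'_def)
  then have "\<bar>apply_bcontfun (G y') i - z\<bar> < \<bar>z\<bar>"
    using d(2)[OF y'] \<delta>(3) dist_coordinate_le[of "G y'" i "G y"] by (simp add: z_def)
  then have "0 \<le> z * apply_bcontfun (G y') i"
    by (auto simp: zero_le_mult_iff abs_if split: if_splits)
  then have "0 \<le> z * weight i * apply_bcontfun (F (G y')) (\<psi> i)"
    by (rule F_sign[OF G_in[OF y']])
  moreover have "apply_bcontfun y' (\<psi> i) = t" using 0 by (simp add: y'_def)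
  ultimately show False using t(2) by (simp add: F_G[OF y'])
qed

text \<open>On the compact cube, \<open>g\<close> inverts \<open>F\<close> followed by relabelling.
  It is expansive as \<open>F\<close> is non-expansive, and \<open>G_support\<close> keeps it inside
  the cube.\<close>

lemma isometry_finite_support:
  assumes I: "finite I" and x: "x \<in> cube I" and y: "y \<in> cube I"
  shows "dist (F x) (F y) = dist x y"
proof -
  let ?S = "reindex (inv \<psi>)" and ?T = "reindex \<psi>"
  have inv: "inv \<psi> (\<psi> n) = n" "\<psi> (inv \<psi> n) = n" for n
    using inj_\<psi> surj_\<psi> by (auto simp: surj_f_inv_f)
  have ST: "?S (?T u) = u" "?T (?S u) = u" for u
    by (auto simp: bcontfun_eq_iff inv)
  have S_in: "?S u \<in> c0_unit_ball" if "u \<in> cube I" for u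
  proof (rule subsetD[OF cube_subset_unit_ball])
    show "finite (\<psi> ` I)" using I by simp
    have "inv \<psi> n \<notin> I" if "n \<notin> \<psi> ` I" for n
      using that inv(2)[of n] by (metis imageI)
    then show "?S u \<in> cube (\<psi> ` I)" using that by (auto simp: cube_def)
  qed
  have T_in: "?T (F u) \<in> cube I" if "u \<in> cube I" for u
  proof -
    have u: "u \<in> c0_unit_ball" using that cube_subset_unit_ball[OF I] by auto
    show ?thesis
      using that F_support[OF u] abs_le_1_unit_ball[OF F_in[OF u]] by (auto simp: cube_def)
  qed
  define g where "g u = G (?S u)" for u
  have gT: "g (?T (F u)) = u" if "u \<in> cube I" for u
    using that cube_subset_unit_ball[OF I] bij_betw_inv_into_left[OF bij]
    by (auto simp: g_def ST)
  have "dist (g (?T (F x))) (g (?T (F y))) = dist (?T (F x)) (?T (F y))"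
  proof (rule compact_expansive_isometry[OF compact_cube[OF I]])
    show "g ` cube I \<subseteq> cube I"
    proof
      fix v assume "v \<in> g ` cube I"
      then obtain u where u: "u \<in> cube I" "v = G (?S u)" by (auto simp: g_def)
      then show "v \<in> cube I"
        using abs_le_1_unit_ball[OF G_in[OF S_in[OF u(1)]]] G_support[OF S_in[OF u(1)]]
        by (auto simp: cube_def inv)
    qed
    fix u v assume "u \<in> cube I" "v \<in> cube I"
    then have uv: "?S u \<in> c0_unit_ball" "?S v \<in> c0_unit_ball" by (auto simp: S_in)
    \<comment> \<open>\<open>?S\<close> cannot shrink distances, since the non-expansive
      \<open>?T\<close> undoes it.\<close>
    have "dist u v \<le> dist (?S u) (?S v)"
      using dist_reindex_le[of \<psi> "?S u" "?S v"] by (simp add: ST)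
    also have "\<dots> \<le> dist (g u) (g v)"
      using nonexp[OF G_in[OF uv(1)] G_in[OF uv(2)]] by (simp add: F_G uv g_def)
    finally show "dist u v \<le> dist (g u) (g v)" .
  qed (use x y T_in in auto)
  then have "dist x y = dist (?T (F x)) (?T (F y))"
    using gT x y by simp
  also have "\<dots> \<le> dist (F x) (F y)" by (rule dist_reindex_le)
  finally show ?thesis
    using nonexp[of x y] x y cube_subset_unit_ball[OF I] by auto
qed

lemma isometry:
  assumes x: "x \<in> c0_unit_ball" and y: "y \<in> c0_unit_ball"
  shows "dist (F x) (F y) = dist x y"
proof (rule antisym[OF nonexp[OF x y]], rule field_le_epsilon)
  fix \<epsilon> :: real assume "0 < \<epsilon>"
  \<comment> \<open>Four errors add up: two truncations and their two images.\<close>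
  then have "0 < \<epsilon> / 4" by simp
  obtain S where S: "finite S" "restrict_seq S (apply_bcontfun x) \<in> c0_unit_ball"
    "dist (restrict_seq S (apply_bcontfun x)) x < \<epsilon> / 4"
    using truncation_approximates[OF x \<open>0 < \<epsilon> / 4\<close>] by metis
  obtain R where R: "finite R" "restrict_seq R (apply_bcontfun y) \<in> c0_unit_ball"
    "dist (restrict_seq R (apply_bcontfun y)) y < \<epsilon> / 4"
    using truncation_approximates[OF y \<open>0 < \<epsilon> / 4\<close>] by metis
  define x' y' where "x' = restrict_seq S (apply_bcontfun x)" "y' = restrict_seq R (apply_bcontfun y)"
  \<comment> \<open>Both truncations lie in the cube over \<open>S \<union> R\<close>.\<close>
  have "dist (F x') (F y') = dist x' y'"
    using isometry_finite_support[of "S \<union> R" x' y'] S(1) R(1) abs_le_1_unit_ball[OF x]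
      abs_le_1_unit_ball[OF y]
    by (auto simp: x'_y'_def cube_def)
  moreover have "dist (F x') (F x) < \<epsilon> / 4" "dist (F y') (F y) < \<epsilon> / 4"
    using nonexp[OF S(2) x] S(3) nonexp[OF R(2) y] R(3) by (auto simp: x'_y'_def)
  moreover have "dist x' x < \<epsilon> / 4" "dist y' y < \<epsilon> / 4"
    using S(3) R(3) by (auto simp: x'_y'_def)
  moreover have "dist x y \<le> dist x' x + dist x' y' + dist y' y" by metric
  moreover have "dist (F x') (F y') \<le> dist (F x') (F x) + dist (F x) (F y) + dist (F y') (F y)"
    by metric
  ultimately show "dist x y \<le> dist (F x) (F y) + \<epsilon>" by linarith
qed

end

theorem theorem3p1:
  fixes F :: "(nat \<Rightarrow>\<^sub>C real) \<Rightarrow> (nat \<Rightarrow>\<^sub>C real)"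
  assumes bij: "bij_betw F c0_unit_ball c0_unit_ball"
    and nonexpansive: "\<forall>x\<in>c0_unit_ball. \<forall>y\<in>c0_unit_ball. dist (F x) (F y) \<le> dist x y"
    and continuous_inverse: "continuous_on c0_unit_ball (inv_into c0_unit_ball F)"
  shows "\<forall>x\<in>c0_unit_ball. \<forall>y\<in>c0_unit_ball. norm (F x - F y) = norm (x - y)"
proof -
  interpret nonexpansive_homeomorphism F
    using assms by unfold_locales auto
  show ?thesis
    using isometry by (simp add: dist_norm)
qed

end
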